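(* Let $c_{4,0},c_{0,3}$ be real constants with $c_{4,0}c_{0,3}\ne0$, let $\rho=c_{0,3}/c_{4,0}$, and let $\Phi$ be a smooth function near $z=0$. Suppose that $$F(t)=\rho\left(\frac t2\right)^4\Phi(z),\qquad z=\rho^2\left(\frac t2\right)^7,$$ satisfies the compatibility equation $\det\mathcal M_\rho[F](t)=0$ for $t$ near $0$. Then $\Phi$ satisfies $\mathcal E[\Phi]=0$, where, with $\theta=z\,\frac{d}{dz}$ and $$A=(4+7\theta)\Phi,\qquad B=(3+7\theta)A,\qquad C=(2+7\theta)B,$$ \begin{align*} \mathcal E[\Phi]={}&240+8C-72B+3B^2+48A-2AC\\ &+z\bigl[-512B+192AB+384A^2-48A^2B-48A^3+4A^3B\\ &\qquad+192\Phi B-768\Phi A+48\Phi A^2+240\Phi^2-24\Phi^2B+12\Phi^2A\bigr]\\ &+z^2\bigl[512A^3-192A^4+24A^5-A^6-1536\Phi A^2+384\Phi A^3-24\Phi A^4\\ &\qquad+1536\Phi^2A-192\Phi^2A^2-512\Phi^3-32\Phi^3A+4\Phi^3A^2+36\Phi^4\bigr]. \end{align*} In particular, the equation $\mathcal E[\Phi]=0$ is independent of $c_{4,0}$ and $c_{0,3}$.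
   Context: The compatibility matrix, depending on $t$ through $t$, $F=F(t)$ and the derivatives $F',F'',F'''$ of $F$ at $t$, is $$\mathcal M_\rho[F]=\begin{pmatrix} 1&\rho t^3&3\rho t^2F&3\rho t(F^2+3t)&\rho(F^3+15tF)&6\rho(F^2+2t)\\ \frac12&3F'&6(F')^2&6F''+4(F')^3&12F'F''&4F'''\\ 0&1&\rho t^3&3\rho t^2F&3\rho t(F^2+2t)&\rho(F^3+9tF)\\ 0&0&1&4F'&4(F')^2&4F''\\ 0&0&1&\rho t^3&3\rho t^2F&3\rho t(F^2+t)\\ 0&0&0&0&1&2F' \end{pmatrix}.$$ *)

theory Defs
  imports "HOL-Analysis.Derivative" "Jordan_Normal_Form.Determinant"
begin

(* Smoothness on a neighbourhood of a point. The ball is open, so the iterated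
   derivatives at its points depend only on the values of f in the ball. *)
definition smooth_near :: "(real \<Rightarrow> real) \<Rightarrow> real \<Rightarrow> bool" where
  "smooth_near f a \<longleftrightarrow>
     (\<exists>e>0. \<forall>n. \<forall>x\<in>ball a e. (deriv ^^ n) f differentiable (at x))"

definition compat_matrix :: "real \<Rightarrow> (real \<Rightarrow> real) \<Rightarrow> real \<Rightarrow> real mat" where
  "compat_matrix \<rho> F t =
    (let f = F t;
         f1 = deriv F t;
         f2 = deriv (deriv F) t;
         f3 = deriv (deriv (deriv F)) t
     in mat_of_rows_list 6
      [[1,   \<rho> * t^3, 3 * \<rho> * t^2 * f, 3 * \<rho> * t * (f^2 + 3 * t), \<rho> * (f^3 + 15 * t * f),     6 * \<rho> * (f^2 + 2 * t)],
       [1/2, 3 * f1,  6 * f1^2,        6 * f2 + 4 * f1^3,         12 * f1 * f2,             4 * f3],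
       [0,   1,       \<rho> * t^3,         3 * \<rho> * t^2 * f,           3 * \<rho> * t * (f^2 + 2 * t), \<rho> * (f^3 + 9 * t * f)],
       [0,   0,       1,               4 * f1,                    4 * f1^2,                 4 * f2],
       [0,   0,       1,               \<rho> * t^3,                   3 * \<rho> * t^2 * f,          3 * \<rho> * t * (f^2 + t)],
       [0,   0,       0,               0,                         1,                        2 * f1]])"

definition theta :: "(real \<Rightarrow> real) \<Rightarrow> real \<Rightarrow> real" where
  "theta f z = z * deriv f z"

definition opA :: "(real \<Rightarrow> real) \<Rightarrow> real \<Rightarrow> real" where
  "opA \<Phi> = (\<lambda>z. 4 * \<Phi> z + 7 * theta \<Phi> z)"

definition opB :: "(real \<Rightarrow> real) \<Rightarrow> real \<Rightarrow> real" where
  "opB \<Phi> = (\<lambda>z. 3 * opA \<Phi> z + 7 * theta (opA \<Phi>) z)"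

definition opC :: "(real \<Rightarrow> real) \<Rightarrow> real \<Rightarrow> real" where
  "opC \<Phi> = (\<lambda>z. 2 * opB \<Phi> z + 7 * theta (opB \<Phi>) z)"

(* The constants c40 and c03 do not occur among the arguments: the equation
   opE \<Phi> z = 0 is one and the same for all their values. *)
definition opE :: "(real \<Rightarrow> real) \<Rightarrow> real \<Rightarrow> real" where
  "opE \<Phi> z =
    (let P = \<Phi> z; A = opA \<Phi> z; B = opB \<Phi> z; C = opC \<Phi> z
     in 240 + 8 * C - 72 * B + 3 * B^2 + 48 * A - 2 * A * C
        + z * (- 512 * B + 192 * A * B + 384 * A^2 - 48 * A^2 * B - 48 * A^3 + 4 * A^3 * B
               + 192 * P * B - 768 * P * A + 48 * P * A^2 + 240 * P^2
               - 24 * P^2 * B + 12 * P^2 * A)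
        + z^2 * (512 * A^3 - 192 * A^4 + 24 * A^5 - A^6
               - 1536 * P * A^2 + 384 * P * A^3 - 24 * P * A^4
               + 1536 * P^2 * A - 192 * P^2 * A^2
               - 512 * P^3 - 32 * P^3 * A + 4 * P^3 * A^2 + 36 * P^4))"

end

theory Submission
  imports Defs
begin

text \<open>
  The substitution is a weighted scaling: with \<open>s = t / 2\<close> and \<open>z = \<rho>\<^sup>2 * s ^ 7\<close>, differentiating
  \<open>c * s ^ (n + 1) * g z\<close> in \<open>t\<close> lowers the power of \<open>s\<close> by one, halves the constant and turns \<open>g\<close>
  into \<open>(n + 1) * g + 7 * theta g\<close>, because \<open>z\<close> is homogeneous of degree 7 in \<open>t\<close>. Starting from
  \<open>F = \<rho> * s ^ 4 * \<Phi> z\<close>, three such steps give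
  \<open>F' = \<rho>/2 * s ^ 3 * A\<close>, \<open>F'' = \<rho>/4 * s ^ 2 * B\<close> and \<open>F''' = \<rho>/8 * s * C\<close>: this is where the
  operators \<open>4 + 7\<theta>\<close>, \<open>3 + 7\<theta>\<close>, \<open>2 + 7\<theta>\<close> come from (\<open>eventually_deriv_scaling\<close>).

  With these values the determinant is homogeneous as well. It equals
  \<open>\<rho>\<^sup>2 * s ^ 4 / 2 * opE \<Phi> z\<close>, an identity of polynomials in \<open>\<rho>\<close>, \<open>s\<close>, \<open>\<Phi>\<close>, \<open>A\<close>, \<open>B\<close>, \<open>C\<close>
  (\<open>det_compat_matrix_scaling\<close>). Hence the compatibility equation makes
  \<open>opE \<Phi> z\<close> vanish at every \<open>z = \<rho>\<^sup>2 * (t / 2) ^ 7\<close> with \<open>t\<close> small and nonzero. Seven being odd,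
  these \<open>z\<close> fill a punctured neighbourhood of 0 on both sides; at 0 itself, where the factor
  \<open>s ^ 4\<close> destroys the information, the equation follows by continuity of \<open>opE \<Phi>\<close>.
\<close>

section \<open>Determinants of explicit matrices\<close>

lemma det_first_column:
  fixes rows :: "'a :: comm_ring_1 list list"
  assumes len: "length rows = Suc n" and rlen: "\<forall>r\<in>set rows. length r = Suc n"
  shows "Determinant.det (mat_of_rows_list (Suc n) rows) =
    (\<Sum>i<Suc n. (-1) ^ i * hd (rows ! i) *
       Determinant.det (mat_of_rows_list n (map tl (take i rows @ drop (Suc i) rows))))"
proof -
  let ?M = "mat_of_rows_list (Suc n) rows"
  have M: "?M \<in> carrier_mat (Suc n) (Suc n)"
    using len by (simp add: mat_of_rows_list_def)
  have "?M $$ (i, 0) * cofactor ?M i 0 = (-1) ^ i * hd (rows ! i) *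
       Determinant.det (mat_of_rows_list n (map tl (take i rows @ drop (Suc i) rows)))"
    if i: "i < Suc n" for i
  proof -
    have len_nth: "length (rows ! k) = Suc n" if "k < Suc n" for k
      using that rlen len by simp
    have "mat_delete ?M i 0 = mat_of_rows_list n (map tl (take i rows @ drop (Suc i) rows))"
      using len i
      by (intro eq_matI)
        (auto simp: mat_delete_def mat_of_rows_list_def nth_append nth_tl len_nth min_def)
    moreover have "rows ! i \<noteq> []"
      using len_nth[OF i] by auto
    ultimately show ?thesis
      using i len by (simp add: cofactor_def mat_of_rows_list_def hd_conv_nth)
  qed
  then show ?thesis
    using laplace_expansion_column[OF M, of 0] by simp
qed

text \<open>
  As a congruence rule this makes the simplifier evaluate the first factor before it looks at the
  second, so that the minors belonging to zero entries are never expanded.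
\<close>

lemma mult_zero_cong:
  fixes a b :: "'a :: mult_zero"
  shows "a = a' \<Longrightarrow> (a' \<noteq> 0 \<Longrightarrow> b = b') \<Longrightarrow> a * b = a' * b'"
  by (cases "a' = 0") auto

text \<open>
  The zero pattern of the compatibility matrix. The functions \<open>K\<close>, \<open>L\<close> and \<open>N\<close> are the minors of
  sizes 3, 4 and 5 that remain after deleting leading columns; each takes as arguments the rows
  that vary between the minors of its size.
\<close>

lemma det_compat_pattern:
  fixes h :: "'a :: comm_ring_1"
  shows "Determinant.det (mat_of_rows_list 6
    [[1, a2, a3, a4, a5, a6], [h, b2, b3, b4, b5, b6], [0, 1, c3, c4, c5, c6],
     [0, 0, 1, d4, d5, d6], [0, 0, 1, e4, e5, e6], [0, 0, 0, 0, 1, f6]]) =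
   (let K = \<lambda>p4 p5 p6 q4 q5 q6. (p4 * q5 - p5 * q4) * f6 - (p4 * q6 - p6 * q4);
        L = \<lambda>u3 u4 u5 u6.
              u3 * K d4 d5 d6 e4 e5 e6 - K u4 u5 u6 e4 e5 e6 + K u4 u5 u6 d4 d5 d6;
        N = \<lambda>x2 x3 x4 x5 x6. x2 * L c3 c4 c5 c6 - L x3 x4 x5 x6
    in N b2 b3 b4 b5 b6 - h * N a2 a3 a4 a5 a6)"
proof -
  have six: "6 = Suc (Suc (Suc (Suc (Suc (Suc 0)))))"
    by simp
  show ?thesis
    unfolding six
    by (simp add: det_first_column mat_of_rows_list_def[of 0] Let_def algebra_simps
        cong: mult_zero_cong)
qed

text \<open>
  Once the values of \<open>F\<close> and its derivatives are known, only polynomial algebra is left. The values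
  of \<open>\<Phi>\<close> and of its images under the operators are named, so that the two sides are polynomials in
  the independent indeterminates \<open>r\<close>, \<open>s\<close>, \<open>P\<close>, \<open>A\<close>, \<open>B\<close>, \<open>C\<close>.
\<close>

lemma det_compat_matrix_scaling:
  fixes r s z P A B C :: real
  assumes z: "z = r\<^sup>2 * s ^ 7"
    and \<Phi>: "\<Phi> z = P" "opA \<Phi> z = A" "opB \<Phi> z = B" "opC \<Phi> z = C"
    and F: "F (2 * s) = r * s ^ 4 * P" "deriv F (2 * s) = r / 2 * s ^ 3 * A"
      "deriv (deriv F) (2 * s) = r / 4 * s\<^sup>2 * B" "deriv (deriv (deriv F)) (2 * s) = r / 8 * s * C"
  shows "Determinant.det (compat_matrix r F (2 * s)) = r\<^sup>2 * s ^ 4 / 2 * opE \<Phi> z"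
proof -
  \<comment> \<open>Clearing all denominators first turns the claim into an identity over the integers.\<close>
  define a b c where "a = A / 2" and "b = B / 4" and "c = C / 8"
  then have ABC: "A = 2 * a" "B = 4 * b" "C = 8 * c"
    by simp_all
  have F': "deriv F (2 * s) = r * s ^ 3 * a" "deriv (deriv F) (2 * s) = r * s\<^sup>2 * b"
    "deriv (deriv (deriv F)) (2 * s) = r * s * c"
    using F by (simp_all add: ABC)
  have half: "2 * (x - 1 / 2 * y) = 2 * x - y" for x y :: real
    by simp
  have "2 * Determinant.det (compat_matrix r F (2 * s)) = r\<^sup>2 * s ^ 4 * opE \<Phi> z"
    unfolding compat_matrix_def opE_def Let_def \<Phi> F(1) F' det_compat_pattern half
    unfolding z ABC by Groebner_Basis.algebra
  then show ?thesis
    by simp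
qed

section \<open>Smoothness\<close>

text \<open>
  Euler-type operators preserve smoothness because the iterated derivatives of \<open>z * f' z\<close> have the
  closed form \<open>z * f\<^sup>(\<^sup>n\<^sup>+\<^sup>1\<^sup>) z + n * f\<^sup>(\<^sup>n\<^sup>) z\<close> on the whole ball where \<open>f\<close> is smooth.
\<close>

lemma smooth_near_euler:
  assumes "smooth_near f a"
  shows "smooth_near (\<lambda>z. c * f z + d * theta f z) a"
proof -
  let ?G = "\<lambda>z. c * f z + d * theta f z"
  let ?D = "\<lambda>n. (deriv ^^ n) f"
  let ?E = "\<lambda>n x. c * ?D n x + d * (x * ?D (Suc n) x + real n * ?D n x)"
  obtain e where e: "e > 0" and diff: "\<And>n x. x \<in> ball a e \<Longrightarrow> ?D n differentiable (at x)"
    using assms unfolding smooth_near_def by blast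
  have D: "(?D n has_real_derivative ?D (Suc n) x) (at x)" if "x \<in> ball a e" for n x
    using diff[OF that, of n] by (simp add: DERIV_deriv_iff_real_differentiable)
  have E: "(?E n has_real_derivative ?E (Suc n) x) (at x)" if "x \<in> ball a e" for n x
    using D[OF that, of n] D[OF that, of "Suc n"]
    by (auto intro!: derivative_eq_intros simp: algebra_simps simp del: funpow.simps)
  have step: "((deriv ^^ n) ?G has_real_derivative ?E (Suc n) x) (at x)"
    if eq: "\<forall>y\<in>ball a e. (deriv ^^ n) ?G y = ?E n y" and x: "x \<in> ball a e" for n x
    using has_field_derivative_transform_within_open[OF E[OF x, of n] open_ball x] eq by simp
  have eq: "\<forall>x\<in>ball a e. (deriv ^^ n) ?G x = ?E n x" for n
  proof (induction n)
    case 0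
    show ?case by (simp add: theta_def)
  next
    case (Suc n)
    show ?case
      using step[OF Suc] by (simp add: DERIV_imp_deriv del: of_nat_Suc)
  qed
  have "(deriv ^^ n) ?G differentiable (at x)" if "x \<in> ball a e" for n x
    using step[OF eq that, of n] real_differentiable_def by blast
  with e show ?thesis
    unfolding smooth_near_def by blast
qed

lemma smooth_near_eventually_differentiable:
  assumes "smooth_near f a"
  shows "\<forall>\<^sub>F x in nhds a. f differentiable (at x)"
proof -
  obtain e where "e > 0" "\<forall>x\<in>ball a e. (deriv ^^ 0) f differentiable (at x)"
    using assms unfolding smooth_near_def by blast
  then show ?thesis
    by (auto simp: eventually_nhds_metric dist_commute)
qed

lemma smooth_near_isCont:
  assumes "smooth_near f a"
  shows "isCont f a"
  using eventually_nhds_x_imp_x[OF smooth_near_eventually_differentiable[OF assms]]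
  by (rule differentiable_imp_continuous_within)

lemma smooth_near_operators:
  assumes "smooth_near \<Phi> a"
  shows "smooth_near (opA \<Phi>) a" "smooth_near (opB \<Phi>) a" "smooth_near (opC \<Phi>) a"
proof -
  show A: "smooth_near (opA \<Phi>) a"
    unfolding opA_def using assms by (rule smooth_near_euler)
  show B: "smooth_near (opB \<Phi>) a"
    unfolding opB_def using A by (rule smooth_near_euler)
  show "smooth_near (opC \<Phi>) a"
    unfolding opC_def using B by (rule smooth_near_euler)
qed

lemma isCont_opE:
  assumes "smooth_near \<Phi> a"
  shows "isCont (opE \<Phi>) a"
  using smooth_near_isCont[OF assms] smooth_near_operators[OF assms, THEN smooth_near_isCont]
  unfolding opE_def Let_def by (intro continuous_intros)

section \<open>Derivatives of scaled functions\<close>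

lemma scaling_has_derivative:
  assumes "g differentiable (at (r\<^sup>2 * (t / 2) ^ 7))"
  shows "((\<lambda>t. c * (t / 2) ^ Suc n * g (r\<^sup>2 * (t / 2) ^ 7)) has_real_derivative
     c / 2 * (t / 2) ^ n * (real (Suc n) * g (r\<^sup>2 * (t / 2) ^ 7)
        + 7 * theta g (r\<^sup>2 * (t / 2) ^ 7))) (at t)"
proof -
  have g: "(g has_real_derivative deriv g (r\<^sup>2 * (t / 2) ^ 7)) (at (r\<^sup>2 * (t / 2) ^ 7))"
    using assms by (simp add: DERIV_deriv_iff_real_differentiable)
  have z: "((\<lambda>t. r\<^sup>2 * (t / 2) ^ 7) has_real_derivative r\<^sup>2 * (7 * (t / 2) ^ 6 / 2)) (at t)"
    by (auto intro!: derivative_eq_intros)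
  have p: "((\<lambda>t. c * (t / 2) ^ Suc n) has_real_derivative c * (real (Suc n) * (t / 2) ^ n / 2)) (at t)"
    by (auto intro!: derivative_eq_intros simp del: power_Suc)
  show ?thesis
    by (rule DERIV_cong[OF DERIV_mult[OF p DERIV_chain2[OF g z]]])
      (simp add: theta_def field_simps eval_nat_numeral)
qed

text \<open>
  The hypothesis and the conclusion have the same form, which allows iteration. Both hold near 0
  rather than at a point because the derivative at \<open>t\<close> depends on \<open>F\<close> around \<open>t\<close>.
\<close>

lemma eventually_deriv_scaling:
  assumes F: "\<forall>\<^sub>F t in nhds 0. F t = c * (t / 2) ^ Suc n * g (r\<^sup>2 * (t / 2) ^ 7)"
    and g: "smooth_near g 0"
  shows "\<forall>\<^sub>F t in nhds 0. deriv F t =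
     c / 2 * (t / 2) ^ n * (real (Suc n) * g (r\<^sup>2 * (t / 2) ^ 7)
        + 7 * theta g (r\<^sup>2 * (t / 2) ^ 7))"
proof -
  have "((\<lambda>t::real. r\<^sup>2 * (t / 2) ^ 7) \<longlongrightarrow> 0) (nhds 0)"
    by (auto intro!: tendsto_eq_intros filterlim_ident)
  then have "\<forall>\<^sub>F t in nhds 0. g differentiable (at (r\<^sup>2 * (t / 2) ^ 7))"
    using smooth_near_eventually_differentiable[OF g]
    by (rule eventually_compose_filterlim[rotated])
  moreover have "\<forall>\<^sub>F t in nhds 0. \<forall>\<^sub>F s in nhds t.
      F s = c * (s / 2) ^ Suc n * g (r\<^sup>2 * (s / 2) ^ 7)"
    using F by (simp add: eventually_eventually)
  ultimately show ?thesis
  proof eventually_elim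
    case (elim t)
    show ?case
      using deriv_cong_ev[OF elim(2) refl] DERIV_imp_deriv[OF scaling_has_derivative[OF elim(1)]]
      by simp
  qed
qed

lemma eventually_deriv_scaled_solution:
  assumes \<Phi>: "smooth_near \<Phi> 0"
    and F: "\<forall>\<^sub>F t in nhds 0. F t = r * (t / 2) ^ 4 * \<Phi> (r\<^sup>2 * (t / 2) ^ 7)"
  shows "\<forall>\<^sub>F t in nhds 0. deriv F t = r / 2 * (t / 2) ^ 3 * opA \<Phi> (r\<^sup>2 * (t / 2) ^ 7)"
    and "\<forall>\<^sub>F t in nhds 0. deriv (deriv F) t = r / 4 * (t / 2)\<^sup>2 * opB \<Phi> (r\<^sup>2 * (t / 2) ^ 7)"
    and "\<forall>\<^sub>F t in nhds 0. deriv (deriv (deriv F)) t = r / 8 * (t / 2) * opC \<Phi> (r\<^sup>2 * (t / 2) ^ 7)"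
proof -
  show F1: "\<forall>\<^sub>F t in nhds 0. deriv F t = r / 2 * (t / 2) ^ 3 * opA \<Phi> (r\<^sup>2 * (t / 2) ^ 7)"
    using eventually_deriv_scaling[of F r 3 \<Phi> r] F \<Phi> by (simp add: opA_def)
  show F2: "\<forall>\<^sub>F t in nhds 0. deriv (deriv F) t = r / 4 * (t / 2)\<^sup>2 * opB \<Phi> (r\<^sup>2 * (t / 2) ^ 7)"
    using eventually_deriv_scaling[of "deriv F" "r / 2" 2 "opA \<Phi>" r]
      F1 smooth_near_operators(1)[OF \<Phi>] by (simp add: opB_def)
  show "\<forall>\<^sub>F t in nhds 0. deriv (deriv (deriv F)) t = r / 8 * (t / 2) * opC \<Phi> (r\<^sup>2 * (t / 2) ^ 7)"
    using eventually_deriv_scaling[of "deriv (deriv F)" "r / 4" 1 "opB \<Phi>" r]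
      F2 smooth_near_operators(2)[OF \<Phi>] by (simp add: opC_def numeral_2_eq_2)
qed

section \<open>From the variable t to the variable z\<close>

text \<open>
  The exponent is odd, so \<open>z = r\<^sup>2 * (t / 2) ^ 7\<close> has the continuous inverse
  \<open>t = 2 * root 7 (z / r\<^sup>2)\<close> on the whole real line.
\<close>

lemma eventually_at_of_scaled_variable:
  fixes r :: real
  assumes r: "r \<noteq> 0" and P: "\<forall>\<^sub>F t in nhds 0. t \<noteq> 0 \<longrightarrow> P (r\<^sup>2 * (t / 2) ^ 7)"
  shows "\<forall>\<^sub>F z in at 0. P z"
proof -
  have "((\<lambda>z. 2 * root 7 (z / r\<^sup>2)) \<longlongrightarrow> 0) (at 0)"
    using r by (auto intro!: tendsto_eq_intros)
  from eventually_compose_filterlim[OF P this]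
  have "\<forall>\<^sub>F z in at 0. 2 * root 7 (z / r\<^sup>2) \<noteq> 0 \<longrightarrow> P (r\<^sup>2 * (2 * root 7 (z / r\<^sup>2) / 2) ^ 7)" .
  then show ?thesis
    using eventually_neq_at_within[of 0 0 UNIV]
  proof eventually_elim
    case (elim z)
    have "root 7 (z / r\<^sup>2) ^ 7 = z / r\<^sup>2"
      by (rule odd_real_root_pow) simp
    then show ?case
      using elim r by simp
  qed
qed

lemma isCont_eq_if_eventually_at:
  fixes f :: "real \<Rightarrow> real"
  assumes "isCont f a" "\<forall>\<^sub>F x in at a. f x = c"
  shows "f a = c"
proof -
  have "(f \<longlongrightarrow> c) (at a)"
    using assms(2) by (rule tendsto_eventually)
  with assms(1) show ?thesis
    unfolding isCont_def by (rule LIM_unique)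
qed

section \<open>The reduced equation\<close>

theorem proposition5p1:
  fixes c40 c03 \<rho> :: real and \<Phi> F :: "real \<Rightarrow> real"
  assumes "c40 * c03 \<noteq> 0"
    and "\<rho> = c03 / c40"
    and "smooth_near \<Phi> 0"
    and "\<forall>\<^sub>F t in nhds 0. F t = \<rho> * (t / 2) ^ 4 * \<Phi> (\<rho>\<^sup>2 * (t / 2) ^ 7)"
    and "\<forall>\<^sub>F t in nhds 0. Determinant.det (compat_matrix \<rho> F t) = 0"
  shows "\<forall>\<^sub>F z in nhds 0. opE \<Phi> z = 0"
proof -
  have \<rho>: "\<rho> \<noteq> 0"
    using assms(1,2) by auto
  have "\<forall>\<^sub>F t in nhds 0. t \<noteq> 0 \<longrightarrow> opE \<Phi> (\<rho>\<^sup>2 * (t / 2) ^ 7) = 0"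
    using assms(4,5) eventually_deriv_scaled_solution[OF assms(3,4)]
  proof eventually_elim
    case (elim t)
    have "Determinant.det (compat_matrix \<rho> F t)
        = \<rho>\<^sup>2 * (t / 2) ^ 4 / 2 * opE \<Phi> (\<rho>\<^sup>2 * (t / 2) ^ 7)"
      using det_compat_matrix_scaling[of _ \<rho> "t / 2" \<Phi> _ _ _ _ F, OF refl refl refl refl refl]
        elim by simp
    with elim(2) \<rho> show ?case
      by auto
  qed
  with \<rho> have punctured: "\<forall>\<^sub>F z in at 0. opE \<Phi> z = 0"
    by (rule eventually_at_of_scaled_variable)
  moreover have "opE \<Phi> 0 = 0"
    using isCont_opE[OF assms(3)] punctured by (rule isCont_eq_if_eventually_at)
  ultimately show ?thesis
    by (simp add: eventually_nhds_conv_at)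
qed

end
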